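(* Let $\lambda>0$ and consider the function $$L(x,\eta):=\lambda\,\mathbb{E}_{\xi\sim P}\,\psi^*\Big(\frac{\ell_\xi(x)-\eta}{\lambda}\Big)+\eta,\qquad (x,\eta)\in\mathbb{R}^d\times\mathbb{R},$$ which is the objective of the equivalent minimization form $\min_{x,\eta}L(x,\eta)$ of the distributionally robust optimization problem $\min_{x}\sup_{Q}\{\mathbb{E}_{\xi\sim Q}[\ell_\xi(x)]-\lambda d_\psi(Q,P)\}$, where $d_\psi(Q,P):=\int\psi\big(\frac{dQ}{dP}\big)dP$. Assume that: (i) each $\ell_\xi:\mathbb{R}^d\to\mathbb{R}$ is $G$-Lipschitz continuous and has $L_\ell$-Lipschitz continuous gradient; (ii) $\mathbb{E}_{\xi\sim P}(\ell_\xi(x)-\ell(x))^2\le\sigma^2$ for all $x$, where $\ell(x):=\mathbb{E}_{\xi\sim P}\ell_\xi(x)$; (iii) $\psi$ is a non-negative convex function with $\psi(1)=0$ and $\psi(t)=+\infty$ for all $t<0$, and its convex conjugate $\psi^*$ is $M$-smooth (has $M$-Lipschitz derivative). Then $L$ belongs to $\mathcal{L}_{\mathrm{sym}}^*(1)$ (as a function on $\mathbb{R}^{d+1}$).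
   Context: $\mathcal{L}_{\mathrm{sym}}^*(1)$ (on $\mathbb{R}^{n}$) is the class of differentiable $f:\mathbb{R}^n\to\mathbb{R}$ for which there are constants $L_0,L_1>0$ with $$\|\nabla f(w')-\nabla f(w)\|\le\Big(L_0+L_1\max_{\theta\in[0,1]}\|\nabla f(\theta w'+(1-\theta)w)\|\Big)\|w'-w\|\quad\text{for all } w,w'\in\mathbb{R}^n.$$ Norms are Euclidean. $\psi^*(s)=\sup_{t}\{st-\psi(t)\}$ is the convex conjugate. *)

theory Defs
  imports "HOL-Probability.Probability"
begin

definition gradient :: "('a::euclidean_space \<Rightarrow> real) \<Rightarrow> 'a \<Rightarrow> 'a" where
  "gradient f x = (THE D. GDERIV f x :> D)"

definition lipschitz_gradient :: "real \<Rightarrow> ('a::euclidean_space \<Rightarrow> real) \<Rightarrow> bool" where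
  "lipschitz_gradient C f \<longleftrightarrow>
     (\<forall>x. f differentiable (at x)) \<and> C-lipschitz_on UNIV (gradient f)"

(* The maximum over [0,1] is expressed by a maximiser \<theta>, so membership in the class
   includes that the maximum exists; a real-valued SUP would be unspecified
   on an unbounded set. *)
definition L_sym_star_1 :: "('a::euclidean_space \<Rightarrow> real) set" where
  "L_sym_star_1 = {f. (\<forall>w. f differentiable (at w)) \<and>
     (\<exists>L0>0. \<exists>L1>0. \<forall>w w'.
        \<exists>\<theta>\<in>{0..1}.
          (\<forall>\<theta>'\<in>{0..1}. norm (gradient f (\<theta>' *\<^sub>R w' + (1 - \<theta>') *\<^sub>R w))
                        \<le> norm (gradient f (\<theta> *\<^sub>R w' + (1 - \<theta>) *\<^sub>R w))) \<and>
          norm (gradient f w' - gradient f w)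
            \<le> (L0 + L1 * norm (gradient f (\<theta> *\<^sub>R w' + (1 - \<theta>) *\<^sub>R w))) * norm (w' - w))}"

(* Intended for functions that never take the value -\<infinity>; then the right-hand side never has the
   form \<infinity> - \<infinity>, and 0 * \<infinity> = 0 in ereal makes the endpoints u = 0, 1 trivial. *)
definition convex_ereal :: "(real \<Rightarrow> ereal) \<Rightarrow> bool" where
  "convex_ereal \<psi> \<longleftrightarrow>
     (\<forall>s t. \<forall>u\<in>{0..1}. \<psi> (u * s + (1 - u) * t) \<le> ereal u * \<psi> s + ereal (1 - u) * \<psi> t)"

definition convex_conjugate :: "(real \<Rightarrow> ereal) \<Rightarrow> real \<Rightarrow> ereal" where
  "convex_conjugate \<psi> s = (SUP t. ereal (s * t) - \<psi> t)"

(* Smoothness includes finiteness: only then is real_of_ereal, which sends \<infinity> and -\<infinity> to 0, harmless. *)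
definition smooth_ereal :: "real \<Rightarrow> (real \<Rightarrow> ereal) \<Rightarrow> bool" where
  "smooth_ereal M \<phi> \<longleftrightarrow>
     (\<forall>s. \<bar>\<phi> s\<bar> \<noteq> \<infinity>) \<and>
     (\<forall>s. (\<lambda>s. real_of_ereal (\<phi> s)) differentiable (at s)) \<and>
     M-lipschitz_on UNIV (deriv (\<lambda>s. real_of_ereal (\<phi> s)))"

definition dro_objective ::
  "real \<Rightarrow> 'b measure \<Rightarrow> (real \<Rightarrow> ereal) \<Rightarrow> ('b \<Rightarrow> 'a \<Rightarrow> real) \<Rightarrow> 'a \<times> real \<Rightarrow> real" where
  "dro_objective lam P \<psi> l = (\<lambda>(x, \<eta>).
     lam * (\<integral>\<xi>. real_of_ereal (convex_conjugate \<psi> ((l \<xi> x - \<eta>) / lam)) \<partial>P) + \<eta>)"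

end

theory Submission imports Defs
begin

text \<open>
  Write \<open>u = (l \<xi> x - \<eta>) / lam\<close>, let \<open>\<phi>\<close> be the real-valued conjugate and \<open>p = \<phi>' u\<close>.
  The integrand of the objective \<open>L\<close> has the gradient \<open>(p \<nabla>l \<xi> x, 1 - p)\<close> in \<open>(x, \<eta>)\<close>. Between two
  points at distance \<open>r\<close> the weight \<open>p\<close> changes by at most \<open>M (G + 1) r / lam\<close>, because \<open>\<phi>'\<close> is
  \<open>M\<close>-Lipschitz, while \<open>\<nabla>l \<xi>\<close> is bounded by \<open>G\<close> and changes by at most \<open>Ll r\<close>. By the product
  rule the gradient of the integrand changes by at most \<open>(K + Ll p) r\<close>, where
  \<open>K = M (G + 1)\<^sup>2 / lam\<close> and \<open>p\<close> is taken at either of the two points.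

  The only term without a uniform bound is \<open>Ll p\<close>, and its mean is controlled by the gradient
  itself: the \<open>\<eta>\<close>-component of the gradient of the objective is \<open>1 - E p\<close>, so
  \<open>E p \<le> 1 + \<parallel>\<nabla>L\<parallel>\<close>. This bounds the mean of \<open>\<bar>p\<bar>\<close> as well, because \<open>p \<ge> 0\<close>: the
  conjugate is nondecreasing, as \<open>\<psi> = \<infinity>\<close> on the negative half-line. Averaging gives
  \<open>\<parallel>\<nabla>L w' - \<nabla>L w\<parallel> \<le> (K + Ll + Ll \<parallel>\<nabla>L w\<parallel>) \<parallel>w' - w\<parallel>\<close>,
  an estimate that uses the gradient at one endpoint only. It implies continuity of \<open>\<nabla>L\<close>, hence
  existence of the maximum over the segment, and the maximum dominates the endpoint
  (\<open>L_sym_star_1I\<close>).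

  What remains is to differentiate under the expectation (\<open>GDERIV_integral\<close>). The bound
  \<open>(K + Ll p) r\<close> has an integrable coefficient, so the pointwise linearisation errors are
  integrable multiples of \<open>r\<^sup>2\<close> and can be averaged. Integrability of the integrand holds
  because \<open>\<phi>\<close> grows at most quadratically and \<open>l \<xi> x\<close> has a finite variance.
\<close>

section \<open>Gradients of real-valued functions\<close>

lemma GDERIV_unique:
  assumes "GDERIV f x :> D" "GDERIV f x :> E"
  shows "D = E"
proof -
  have "(\<lambda>h. h \<bullet> D) = (\<lambda>h. h \<bullet> E)"
    using assms unfolding gderiv_def by (rule has_derivative_unique)
  then have "h \<bullet> D = h \<bullet> E" for h
    by metis
  then show ?thesis
    by (metis inner_commute vector_eq_rdot)
qed

lemma gradient_eqI:
  assumes "GDERIV f x :> D"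
  shows "gradient f x = D"
  unfolding gradient_def using assms GDERIV_unique by blast

lemma GDERIV_gradient:
  fixes f :: "'a::euclidean_space \<Rightarrow> real"
  assumes "f differentiable (at x)"
  shows "GDERIV f x :> gradient f x"
proof -
  obtain f' where f': "(f has_derivative f') (at x)"
    using assms by (auto simp: differentiable_def)
  have lin: "linear f'"
    using f' by (rule has_derivative_linear)
  \<comment> \<open>The Riesz representative of the Frechet derivative.\<close>
  define D where "D = (\<Sum>b\<in>Basis. f' b *\<^sub>R b)"
  have "f' h = h \<bullet> D" for h
  proof -
    have "f' h = f' (\<Sum>b\<in>Basis. (h \<bullet> b) *\<^sub>R b)"
      by (simp add: euclidean_representation)
    also have "\<dots> = (\<Sum>b\<in>Basis. (h \<bullet> b) * f' b)"
      by (simp add: linear_sum[OF lin] linear_cmul[OF lin])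
    also have "\<dots> = h \<bullet> D"
      by (simp add: D_def inner_sum_right mult.commute)
    finally show ?thesis .
  qed
  then have "f' = (\<lambda>h. h \<bullet> D)" by auto
  with f' have "GDERIV f x :> D"
    by (simp add: gderiv_def)
  then show ?thesis
    using gradient_eqI by blast
qed

lemma GDERIV_difference_quotient:
  fixes f :: "'a::real_inner \<Rightarrow> real"
  assumes "GDERIV f x :> D"
  shows "((\<lambda>t. (f (x + t *\<^sub>R v) - f x) / t) \<longlongrightarrow> v \<bullet> D) (at 0)"
proof -
  have f': "(f has_derivative (\<lambda>h. h \<bullet> D)) (at (x + 0 *\<^sub>R v))"
    using assms by (simp add: gderiv_def)
  have "((\<lambda>t. f (x + t *\<^sub>R v)) has_derivative (\<lambda>t. (t *\<^sub>R v) \<bullet> D)) (at 0)"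
    by (rule has_derivative_compose[where f = "\<lambda>t. x + t *\<^sub>R v" and g = f, OF _ f'])
       (auto intro!: derivative_eq_intros)
  then have "((\<lambda>t. f (x + t *\<^sub>R v)) has_field_derivative (v \<bullet> D)) (at 0)"
    by (simp add: has_field_derivative_def mult_commute_abs)
  then show ?thesis
    by (simp add: has_field_derivative_iff)
qed

lemma norm_GDERIV_le_lipschitz:
  fixes f :: "'a::real_inner \<Rightarrow> real"
  assumes D: "GDERIV f x :> D" and lip: "G-lipschitz_on UNIV f"
  shows "norm D \<le> G"
proof (cases "D = 0")
  case True
  then show ?thesis using lipschitz_on_nonneg[OF lip] by simp
next
  case False
  \<comment> \<open>In the direction of the gradient itself the difference quotients tend to \<open>\<parallel>D\<parallel>\<^sup>2\<close>.\<close>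
  have "\<bar>(f (x + t *\<^sub>R D) - f x) / t\<bar> \<le> G * norm D" if "t \<noteq> 0" for t
  proof -
    have "\<bar>f (x + t *\<^sub>R D) - f x\<bar> \<le> G * (\<bar>t\<bar> * norm D)"
      using lipschitz_onD[OF lip, of "x + t *\<^sub>R D" x] by (simp add: dist_norm)
    then show ?thesis
      using that by (simp add: abs_divide divide_simps mult_ac)
  qed
  then have "\<bar>D \<bullet> D\<bar> \<le> G * norm D"
    by (intro tendsto_upperbound[OF tendsto_rabs[OF GDERIV_difference_quotient[OF D]]])
       (auto simp: eventually_at_filter)
  then have "norm D * norm D \<le> G * norm D"
    by (simp add: power2_norm_eq_inner[symmetric] power2_eq_square)
  with False show ?thesis by simp
qed

text \<open>
  The gradient has to be Lipschitz only relative to the base point \<open>w\<close>, so that the constant may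
  depend on \<open>w\<close>; this is the situation for functions whose smoothness degrades with the size of
  their gradient. The sharp constant would be \<open>C / 2\<close>; the mean value inequality already gives \<open>C\<close>.
\<close>

lemma linearization_error_le:
  fixes f :: "'a::real_inner \<Rightarrow> real"
  assumes D: "\<And>z. GDERIV f z :> g z"
    and C: "\<And>z. norm (g z - g w) \<le> C * norm (z - w)"
  shows "\<bar>f z - f w - (z - w) \<bullet> g w\<bar> \<le> C * (norm (z - w))\<^sup>2"
proof (cases "z = w")
  case True
  then show ?thesis by simp
next
  case False
  have "0 \<le> C * norm (z - w)"
    using C[of z] norm_ge_zero order_trans by blast
  with False have C0: "0 \<le> C"
    by (simp add: zero_le_mult_iff)
  let ?S = "closed_segment w z"
  have "norm (f z - f w - (z - w) \<bullet> g w) \<le> norm (z - w) * (C * norm (z - w))"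
  proof (rule differentiable_bound_linearization[where S = ?S and ?x0.0 = w and f' = "\<lambda>y h. h \<bullet> g y"])
    fix t :: real assume "t \<in> {0..1}"
    then show "w + t *\<^sub>R (z - w) \<in> ?S"
      by (auto simp: in_segment algebra_simps intro!: exI[of _ t])
  next
    fix y assume "y \<in> ?S"
    show "(f has_derivative (\<lambda>h. h \<bullet> g y)) (at y within ?S)"
      using D[of y] by (auto simp: gderiv_def intro: has_derivative_at_withinI)
  next
    fix y assume y: "y \<in> ?S"
    have "norm ((h \<bullet> g y) - h \<bullet> g w) \<le> C * norm (z - w) * norm h" for h
    proof -
      have "norm ((h \<bullet> g y) - h \<bullet> g w) \<le> norm h * norm (g y - g w)"
        by (metis Cauchy_Schwarz_ineq2 inner_diff_right real_norm_def)
      also have "\<dots> \<le> norm h * (C * norm (z - w))"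
      proof (rule mult_left_mono)
        have "norm (y - w) \<le> norm (z - w)"
          using y by (metis segment_bound(1))
        then show "norm (g y - g w) \<le> C * norm (z - w)"
          using C[of y] C0 by (meson mult_left_mono order_trans)
      qed auto
      finally show ?thesis by (simp add: mult_ac)
    qed
    then show "onorm ((\<lambda>h. h \<bullet> g y) - (\<lambda>h. h \<bullet> g w)) \<le> C * norm (z - w)"
      using C0 by (intro onorm_bound) (auto simp: fun_diff_def)
  qed simp
  then show ?thesis by (simp add: power2_eq_square mult_ac)
qed

section \<open>Differentiation under the integral\<close>

text \<open>
  Each coordinate of the gradient is a pointwise limit of difference quotients along a sequence of
  step sizes, and each difference quotient is measurable.
\<close>

lemma borel_measurable_GDERIV:
  fixes F :: "'b \<Rightarrow> 'a::euclidean_space \<Rightarrow> real"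
  assumes meas: "\<And>w. (\<lambda>\<xi>. F \<xi> w) \<in> borel_measurable P"
    and D: "\<And>\<xi>. \<xi> \<in> space P \<Longrightarrow> GDERIV (F \<xi>) w :> g \<xi>"
  shows "g \<in> borel_measurable P"
proof (rule borel_measurable_euclidean_space[THEN iffD2], intro ballI)
  fix b :: 'a
  let ?t = "\<lambda>n. inverse (real (Suc n))"
  have t: "filterlim ?t (at 0) sequentially"
    using LIMSEQ_inverse_real_of_nat by (simp add: filterlim_at del: of_nat_Suc)
  have "(\<lambda>\<xi>. b \<bullet> g \<xi>) \<in> borel_measurable P"
  proof (rule borel_measurable_LIMSEQ_real)
    fix \<xi> assume "\<xi> \<in> space P"
    show "(\<lambda>n. (F \<xi> (w + ?t n *\<^sub>R b) - F \<xi> w) / ?t n) \<longlonglongrightarrow> b \<bullet> g \<xi>"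
      using filterlim_compose[OF GDERIV_difference_quotient[OF D[OF \<open>\<xi> \<in> space P\<close>]] t] .
  next
    fix n
    show "(\<lambda>\<xi>. (F \<xi> (w + ?t n *\<^sub>R b) - F \<xi> w) / ?t n) \<in> borel_measurable P"
      using meas by measurable
  qed
  then show "(\<lambda>\<xi>. g \<xi> \<bullet> b) \<in> borel_measurable P"
    by (simp add: inner_commute)
qed

lemma norm_integral_le_integral:
  fixes f :: "'b \<Rightarrow> 'a::{banach, second_countable_topology}"
  assumes f: "integrable P f" and C: "integrable P C"
    and bound: "\<And>\<xi>. \<xi> \<in> space P \<Longrightarrow> norm (f \<xi>) \<le> C \<xi>"
  shows "norm (\<integral>\<xi>. f \<xi> \<partial>P) \<le> (\<integral>\<xi>. C \<xi> \<partial>P)"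
proof -
  have "norm (\<integral>\<xi>. f \<xi> \<partial>P) \<le> (\<integral>\<xi>. norm (f \<xi>) \<partial>P)"
    by (rule integral_norm_bound)
  also have "\<dots> \<le> (\<integral>\<xi>. C \<xi> \<partial>P)"
    using assms by (intro integral_mono) auto
  finally show ?thesis .
qed

text \<open>
  A gradient that is Lipschitz relative to \<open>w\<close> with an integrable constant \<open>C \<xi>\<close> makes the
  linearisation errors at \<open>w\<close> quadratic with the same constants. Their integral is at most
  \<open>c \<parallel>z - w\<parallel>\<^sup>2\<close> with \<open>c\<close> the integral of \<open>C\<close>, so the integrated gradient is the gradient of the
  integral.
\<close>

lemma GDERIV_integral:
  fixes F :: "'b \<Rightarrow> 'a::euclidean_space \<Rightarrow> real"
  assumes F: "\<And>w. integrable P (\<lambda>\<xi>. F \<xi> w)"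
    and g: "integrable P (\<lambda>\<xi>. g \<xi> w)"
    and C: "integrable P C"
    and D: "\<And>\<xi> z. \<xi> \<in> space P \<Longrightarrow> GDERIV (F \<xi>) z :> g \<xi> z"
    and lip: "\<And>\<xi> z. \<xi> \<in> space P \<Longrightarrow> norm (g \<xi> z - g \<xi> w) \<le> C \<xi> * norm (z - w)"
  shows "GDERIV (\<lambda>w. \<integral>\<xi>. F \<xi> w \<partial>P) w :> (\<integral>\<xi>. g \<xi> w \<partial>P)"
proof -
  let ?L = "\<lambda>w. \<integral>\<xi>. F \<xi> w \<partial>P" and ?D = "\<integral>\<xi>. g \<xi> w \<partial>P"
  define c where "c = (\<integral>\<xi>. C \<xi> \<partial>P)"
  have err: "\<bar>?L z - ?L w - (z - w) \<bullet> ?D\<bar> \<le> c * (norm (z - w))\<^sup>2" for z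
  proof -
    have "\<bar>?L z - ?L w - (z - w) \<bullet> ?D\<bar>
        = norm (\<integral>\<xi>. F \<xi> z - F \<xi> w - (z - w) \<bullet> g \<xi> w \<partial>P)"
      using F g by simp
    also have "\<dots> \<le> (\<integral>\<xi>. C \<xi> * (norm (z - w))\<^sup>2 \<partial>P)"
    proof (rule norm_integral_le_integral)
      show "integrable P (\<lambda>\<xi>. F \<xi> z - F \<xi> w - (z - w) \<bullet> g \<xi> w)"
        using F g by auto
      show "norm (F \<xi> z - F \<xi> w - (z - w) \<bullet> g \<xi> w) \<le> C \<xi> * (norm (z - w))\<^sup>2"
        if "\<xi> \<in> space P" for \<xi>
        using linearization_error_le[of "F \<xi>" "g \<xi>", OF D lip] that by simp
    qed (use C in auto)
    also have "\<dots> = c * (norm (z - w))\<^sup>2"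
      by (simp add: c_def)
    finally show ?thesis .
  qed
  show ?thesis
    unfolding gderiv_def has_derivative_at
  proof (intro conjI)
    show "bounded_linear (\<lambda>h. h \<bullet> ?D)"
      by (rule bounded_linear_inner_left)
    show "(\<lambda>h. norm (?L (w + h) - ?L w - h \<bullet> ?D) / norm h) \<midarrow>0\<rightarrow> 0"
    proof (rule Lim_null_comparison)
      have "norm (norm (?L (w + h) - ?L w - h \<bullet> ?D) / norm h) \<le> c * norm h" if "h \<noteq> 0" for h
        using err[of "w + h"] that by (simp add: divide_simps power2_eq_square mult_ac)
      then show "\<forall>\<^sub>F h in at 0. norm (norm (?L (w + h) - ?L w - h \<bullet> ?D) / norm h) \<le> c * norm h"
        by (auto simp: eventually_at_filter)
      show "(\<lambda>h. c * norm h) \<midarrow>0\<rightarrow> 0"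
        by (auto intro!: tendsto_eq_intros)
    qed
  qed
qed

section \<open>Membership in the class\<close>

text \<open>
  An estimate in terms of the gradient at one endpoint suffices. It makes \<open>g\<close> continuous, so the
  norm of \<open>g\<close> attains a maximum on the compact segment, and that maximum dominates the value at
  the endpoint.
\<close>

lemma L_sym_star_1I:
  fixes f :: "'a::euclidean_space \<Rightarrow> real"
  assumes D: "\<And>w. GDERIV f w :> g w"
    and pos: "0 < L0" "0 < L1"
    and bound: "\<And>w w'. norm (g w' - g w) \<le> (L0 + L1 * norm (g w)) * norm (w' - w)"
  shows "f \<in> L_sym_star_1"
proof -
  have grad: "gradient f = g"
    using gradient_eqI[OF D] by auto
  have diff: "f differentiable (at w)" for w
    using D[of w] by (auto simp: gderiv_def differentiable_def)
  have "isCont g w" for w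
  proof -
    have "(\<lambda>z. g z - g w) \<midarrow>w\<rightarrow> 0"
    proof (rule Lim_null_comparison)
      show "\<forall>\<^sub>F z in at w. norm (g z - g w) \<le> (L0 + L1 * norm (g w)) * norm (z - w)"
        using bound by simp
      show "(\<lambda>z. (L0 + L1 * norm (g w)) * norm (z - w)) \<midarrow>w\<rightarrow> 0"
        by (auto intro!: tendsto_eq_intros)
    qed
    then show ?thesis
      unfolding isCont_def using LIM_zero_iff by blast
  qed
  then have cont: "continuous_on A g" for A
    by (simp add: continuous_at_imp_continuous_on)
  have max: "\<exists>\<theta>\<in>{0..1}.
      (\<forall>\<theta>'\<in>{0..1}. norm (g (\<theta>' *\<^sub>R w' + (1 - \<theta>') *\<^sub>R w)) \<le> norm (g (\<theta> *\<^sub>R w' + (1 - \<theta>) *\<^sub>R w))) \<and>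
      norm (g w' - g w) \<le> (L0 + L1 * norm (g (\<theta> *\<^sub>R w' + (1 - \<theta>) *\<^sub>R w))) * norm (w' - w)"
    for w w'
  proof -
    let ?n = "\<lambda>\<theta>::real. norm (g (\<theta> *\<^sub>R w' + (1 - \<theta>) *\<^sub>R w))"
    have "continuous_on {0..1} ?n"
      by (intro continuous_on_norm continuous_on_compose2[OF cont[of UNIV]] continuous_intros) auto
    then obtain \<theta> where \<theta>: "\<theta> \<in> {0..1}" "\<forall>\<theta>'\<in>{0..1}. ?n \<theta>' \<le> ?n \<theta>"
      using continuous_attains_sup[of "{0..1::real}" ?n] by auto
    have "norm (g w) \<le> ?n \<theta>"
      using \<theta>(2)[rule_format, of 0] by simp
    then have "(L0 + L1 * norm (g w)) * norm (w' - w) \<le> (L0 + L1 * ?n \<theta>) * norm (w' - w)"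
      using pos by (intro mult_right_mono add_left_mono mult_left_mono) auto
    then show ?thesis
      using \<theta> bound[of w' w] by (intro bexI[of _ \<theta>]) auto
  qed
  show ?thesis
    unfolding L_sym_star_1_def mem_Collect_eq grad
    using diff pos max by blast
qed

section \<open>The convex conjugate and the integrand\<close>

text \<open>
  Only \<open>t \<ge> 0\<close> contributes to the supremum that defines the conjugate, and for such \<open>t\<close> the
  function \<open>s t - \<psi> t\<close> is nondecreasing in \<open>s\<close>.
\<close>

lemma mono_convex_conjugate:
  assumes "\<And>t. t < 0 \<Longrightarrow> \<psi> t = \<infinity>"
  shows "mono (convex_conjugate \<psi>)"
proof (rule monoI)
  fix s s' :: real assume "s \<le> s'"
  show "convex_conjugate \<psi> s \<le> convex_conjugate \<psi> s'"
    unfolding convex_conjugate_def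
  proof (rule SUP_mono)
    fix t
    have "ereal (s * t) - \<psi> t \<le> ereal (s' * t) - \<psi> t"
    proof (cases "t < 0")
      case True
      then show ?thesis by (simp add: assms)
    next
      case False
      with \<open>s \<le> s'\<close> show ?thesis
        by (intro ereal_minus_mono) (auto intro: mult_right_mono)
    qed
    then show "\<exists>t'\<in>UNIV. ereal (s * t) - \<psi> t \<le> ereal (s' * t') - \<psi> t'"
      by blast
  qed
qed

text \<open>
  The second component \<open>1 - p\<close> is what makes the weight \<open>p\<close>, which is unbounded in general,
  a quantity controlled by the gradient.
\<close>

lemma GDERIV_scaled_compose:
  fixes l :: "'a::real_inner \<Rightarrow> real"
  assumes l: "GDERIV l (fst w) :> d"
    and \<phi>: "DERIV \<phi> ((l (fst w) - snd w) / lam) :> p"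
    and lam: "lam \<noteq> 0"
  shows "GDERIV (\<lambda>w. lam * \<phi> ((l (fst w) - snd w) / lam) + snd w) w :> (p *\<^sub>R d, 1 - p)"
proof -
  let ?u = "\<lambda>w. (l (fst w) - snd w) / lam"
  have "(l has_derivative (\<lambda>h. h \<bullet> d)) (at (fst w))"
    using l by (simp add: gderiv_def)
  then have l': "((\<lambda>w. l (fst w)) has_derivative (\<lambda>h. fst h \<bullet> d)) (at w)"
    by (rule has_derivative_compose[rotated]) (auto intro!: derivative_eq_intros)
  have u': "(?u has_derivative (\<lambda>h. (fst h \<bullet> d - snd h) / lam)) (at w)"
    using l' lam by (auto intro!: derivative_eq_intros simp: field_simps)
  have "(\<phi> has_derivative (*) p) (at (?u w))"
    using \<phi> by (simp add: has_field_derivative_def)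
  from has_derivative_compose[OF u' this]
  have "((\<lambda>w. lam * \<phi> (?u w) + snd w) has_derivative
      (\<lambda>h. lam * (p * ((fst h \<bullet> d - snd h) / lam)) + snd h)) (at w)"
    by (auto intro!: derivative_eq_intros)
  moreover have "lam * (p * ((fst h \<bullet> d - snd h) / lam)) + snd h = h \<bullet> (p *\<^sub>R d, 1 - p)" for h
    using lam by (simp add: inner_prod_def field_simps)
  ultimately show ?thesis
    by (simp add: gderiv_def)
qed

section \<open>Smoothness of the objective\<close>

theorem lemma3p4:
  fixes lam G Ll \<sigma> M :: real
    and P :: "'b measure"
    and l :: "'b \<Rightarrow> real ^ 'd \<Rightarrow> real"
    and \<psi> :: "real \<Rightarrow> ereal"
  assumes "lam > 0"
    and "prob_space P"
    and "\<And>x. integrable P (\<lambda>\<xi>. l \<xi> x)"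
    and "\<And>\<xi>. \<xi> \<in> space P \<Longrightarrow> G-lipschitz_on UNIV (l \<xi>)"
    and "\<And>\<xi>. \<xi> \<in> space P \<Longrightarrow> lipschitz_gradient Ll (l \<xi>)"
    and "\<And>x. integrable P (\<lambda>\<xi>. (l \<xi> x - (\<integral>\<zeta>. l \<zeta> x \<partial>P))\<^sup>2)"
    and "\<And>x. (\<integral>\<xi>. (l \<xi> x - (\<integral>\<zeta>. l \<zeta> x \<partial>P))\<^sup>2 \<partial>P) \<le> \<sigma>\<^sup>2"
    and "\<And>t. 0 \<le> \<psi> t"
    and "convex_ereal \<psi>"
    and "\<psi> 1 = 0"
    and "\<And>t. t < 0 \<Longrightarrow> \<psi> t = \<infinity>"
    and "smooth_ereal M (convex_conjugate \<psi>)"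
  shows "dro_objective lam P \<psi> l \<in> L_sym_star_1"
proof -
  interpret prob_space P by fact
  note lam = assms(1) and int_l = assms(3) and lip_l = assms(4)
  define \<phi> where "\<phi> s = real_of_ereal (convex_conjugate \<psi> s)" for s
  define \<phi>' where "\<phi>' = deriv \<phi>"
  have fin: "\<bar>convex_conjugate \<psi> s\<bar> \<noteq> \<infinity>" for s
    using assms(12) by (simp add: smooth_ereal_def)
  have D\<phi>: "DERIV \<phi> s :> \<phi>' s" for s
    using assms(12)
    by (simp add: smooth_ereal_def \<phi>_def[abs_def] \<phi>'_def DERIV_deriv_iff_real_differentiable)
  have lip_\<phi>': "M-lipschitz_on UNIV \<phi>'"
    using assms(12) by (simp add: smooth_ereal_def \<phi>_def[abs_def] \<phi>'_def)
  then have M: "0 \<le> M"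
    by (rule lipschitz_on_nonneg)
  have "mono \<phi>"
    using mono_convex_conjugate[of \<psi>, OF assms(11)] fin
    unfolding mono_def \<phi>_def by (metis ereal_less_eq(3) ereal_real)
  then have \<phi>'_nonneg: "0 \<le> \<phi>' s" for s
    using mono_on_imp_deriv_nonneg[of UNIV \<phi>, OF _ D\<phi>] by simp
  have \<phi>'_diff: "\<bar>\<phi>' s - \<phi>' t\<bar> \<le> M * \<bar>s - t\<bar>" for s t
    using lipschitz_onD[OF lip_\<phi>', of s t] by (simp add: dist_real_def)

  obtain \<xi>0 where \<xi>0: "\<xi>0 \<in> space P"
    using not_empty by auto
  have G: "0 \<le> G"
    using lip_l[OF \<xi>0] by (rule lipschitz_on_nonneg)
  define d where "d \<xi> = gradient (l \<xi>)" for \<xi>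
  have lip_d: "Ll-lipschitz_on UNIV (d \<xi>)" if "\<xi> \<in> space P" for \<xi>
    using assms(5)[OF that] by (simp add: lipschitz_gradient_def d_def)
  have Ll: "0 \<le> Ll"
    using lip_d[OF \<xi>0] by (rule lipschitz_on_nonneg)
  have Dl: "GDERIV (l \<xi>) x :> d \<xi> x" if "\<xi> \<in> space P" for \<xi> x
    using assms(5)[OF that] by (simp add: lipschitz_gradient_def d_def GDERIV_gradient)
  have norm_d: "norm (d \<xi> x) \<le> G" if "\<xi> \<in> space P" for \<xi> x
    using norm_GDERIV_le_lipschitz[OF Dl[OF that] lip_l[OF that]] .

  define u where "u \<xi> w = (l \<xi> (fst w) - snd w) / lam" for \<xi> and w :: "(real ^ 'd) \<times> real"
  define p where "p \<xi> w = \<phi>' (u \<xi> w)" for \<xi> w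
  define F where "F \<xi> w = lam * \<phi> (u \<xi> w) + snd w" for \<xi> w
  define g where "g \<xi> w = (p \<xi> w *\<^sub>R d \<xi> (fst w), 1 - p \<xi> w)" for \<xi> w
  have p_nonneg: "0 \<le> p \<xi> w" for \<xi> w
    by (simp add: p_def \<phi>'_nonneg)

  have DF: "GDERIV (F \<xi>) w :> g \<xi> w" if "\<xi> \<in> space P" for \<xi> w
    unfolding F_def[abs_def] g_def p_def u_def
    using Dl[OF that] D\<phi> lam by (intro GDERIV_scaled_compose) auto

  \<comment> \<open>The argument \<open>u\<close> is \<open>(G + 1) / lam\<close>-Lipschitz in \<open>w\<close>. The second factor \<open>G + 1\<close> in \<open>K\<close>
      bounds the sensitivity of the gradient to \<open>p\<close>: \<open>G\<close> from the \<open>x\<close>-part, \<open>1\<close> from the \<open>\<eta>\<close>-part.\<close>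
  define K where "K = M * (G + 1)\<^sup>2 / lam"
  have K: "0 \<le> K"
    using M lam by (simp add: K_def)
  have g_diff: "norm (g \<xi> w' - g \<xi> w) \<le> (K + Ll * p \<xi> w) * norm (w' - w)"
    if \<xi>: "\<xi> \<in> space P" for \<xi> w w'
  proof -
    have x: "norm (fst w' - fst w) \<le> norm (w' - w)" and \<eta>: "\<bar>snd w' - snd w\<bar> \<le> norm (w' - w)"
      using norm_fst_le[of "fst (w' - w)" "snd (w' - w)"] norm_snd_le[of "snd (w' - w)" "fst (w' - w)"]
      by (auto simp: minus_prod_def)
    have "\<bar>l \<xi> (fst w') - l \<xi> (fst w)\<bar> \<le> G * norm (fst w' - fst w)"
      using lipschitz_onD[OF lip_l[OF \<xi>], of "fst w'" "fst w"] by (simp add: dist_norm)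
    also have "\<dots> \<le> G * norm (w' - w)"
      using x G by (rule mult_left_mono)
    finally have "\<bar>(l \<xi> (fst w') - snd w') - (l \<xi> (fst w) - snd w)\<bar> \<le> (G + 1) * norm (w' - w)"
      using \<eta> by (simp add: algebra_simps)
    then have "\<bar>u \<xi> w' - u \<xi> w\<bar> \<le> (G + 1) * norm (w' - w) / lam"
      using lam by (simp add: u_def diff_divide_distrib[symmetric] divide_right_mono)
    then have p_diff: "\<bar>p \<xi> w' - p \<xi> w\<bar> \<le> M * ((G + 1) * norm (w' - w) / lam)"
      unfolding p_def using \<phi>'_diff M by (meson mult_left_mono order_trans)
    have d_diff: "norm (d \<xi> (fst w') - d \<xi> (fst w)) \<le> Ll * norm (w' - w)"
      using lipschitz_onD[OF lip_d[OF \<xi>], of "fst w'" "fst w"] mult_left_mono[OF x Ll]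
      by (simp add: dist_norm)
    have "g \<xi> w' - g \<xi> w =
        ((p \<xi> w' - p \<xi> w) *\<^sub>R d \<xi> (fst w') + p \<xi> w *\<^sub>R (d \<xi> (fst w') - d \<xi> (fst w)), p \<xi> w - p \<xi> w')"
      by (simp add: g_def algebra_simps)
    then have "norm (g \<xi> w' - g \<xi> w) \<le>
        norm ((p \<xi> w' - p \<xi> w) *\<^sub>R d \<xi> (fst w') + p \<xi> w *\<^sub>R (d \<xi> (fst w') - d \<xi> (fst w)))
        + \<bar>p \<xi> w - p \<xi> w'\<bar>"
      by (metis norm_Pair_le real_norm_def)
    also have "\<dots> \<le> (\<bar>p \<xi> w' - p \<xi> w\<bar> * norm (d \<xi> (fst w'))
        + p \<xi> w * norm (d \<xi> (fst w') - d \<xi> (fst w))) + \<bar>p \<xi> w' - p \<xi> w\<bar>"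
      using p_nonneg[of \<xi> w] by (intro add_mono norm_triangle_le) auto
    also have "\<dots> \<le> (\<bar>p \<xi> w' - p \<xi> w\<bar> * G + p \<xi> w * (Ll * norm (w' - w))) + \<bar>p \<xi> w' - p \<xi> w\<bar>"
      using norm_d[OF \<xi>] d_diff p_nonneg by (intro add_mono mult_left_mono) auto
    also have "\<dots> = \<bar>p \<xi> w' - p \<xi> w\<bar> * (G + 1) + Ll * p \<xi> w * norm (w' - w)"
      by (simp add: algebra_simps)
    also have "\<dots> \<le> M * ((G + 1) * norm (w' - w) / lam) * (G + 1) + Ll * p \<xi> w * norm (w' - w)"
      using p_diff G by (intro add_mono mult_right_mono) (auto simp: p_nonneg)
    also have "\<dots> = (K + Ll * p \<xi> w) * norm (w' - w)"
      by (simp add: K_def power2_eq_square algebra_simps add_divide_distrib)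
    finally show ?thesis .
  qed

  have int_u: "integrable P (\<lambda>\<xi>. u \<xi> w)" for w
    unfolding u_def using int_l by auto
  have int_u2: "integrable P (\<lambda>\<xi>. (u \<xi> w)\<^sup>2)" for w
  proof -
    define m where "m = (\<integral>\<zeta>. l \<zeta> (fst w) \<partial>P)"
    \<comment> \<open>Expanding around the mean expresses \<open>u\<^sup>2\<close> through the variance integrand.\<close>
    have "integrable P (\<lambda>\<xi>. ((l \<xi> (fst w) - m)\<^sup>2 + 2 * (m - snd w) * l \<xi> (fst w) + ((snd w)\<^sup>2 - m\<^sup>2)) / lam\<^sup>2)"
      using assms(6)[of "fst w"] int_l[of "fst w"] by (simp add: m_def)
    moreover have "((l \<xi> (fst w) - m)\<^sup>2 + 2 * (m - snd w) * l \<xi> (fst w) + ((snd w)\<^sup>2 - m\<^sup>2)) / lam\<^sup>2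
        = (u \<xi> w)\<^sup>2" for \<xi>
      by (simp add: u_def power_divide) (simp add: power2_eq_square algebra_simps)
    ultimately show ?thesis by simp
  qed
  have meas_u: "(\<lambda>\<xi>. u \<xi> w) \<in> borel_measurable P" for w
    using int_u by (rule borel_measurable_integrable)
  have "continuous_on UNIV \<phi>"
    using D\<phi> by (meson DERIV_isCont continuous_at_imp_continuous_on)
  then have meas_\<phi>: "(\<lambda>\<xi>. \<phi> (u \<xi> w)) \<in> borel_measurable P" for w
    using meas_u by (rule borel_measurable_continuous_on)
  have meas_p: "(\<lambda>\<xi>. p \<xi> w) \<in> borel_measurable P" for w
    unfolding p_def
    using lipschitz_on_continuous_on[OF lip_\<phi>'] meas_u by (rule borel_measurable_continuous_on)
  have int_p: "integrable P (\<lambda>\<xi>. p \<xi> w)" for w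
  proof (rule Bochner_Integration.integrable_bound)
    show "integrable P (\<lambda>\<xi>. \<phi>' 0 + M * \<bar>u \<xi> w\<bar>)"
      using int_u by auto
    have "\<phi>' s \<le> \<phi>' 0 + M * \<bar>s\<bar>" for s
      using \<phi>'_diff[of s 0] by auto
    then show "AE \<xi> in P. norm (p \<xi> w) \<le> norm (\<phi>' 0 + M * \<bar>u \<xi> w\<bar>)"
      using \<phi>'_nonneg M by (auto simp: p_def)
  qed (rule meas_p)
  have int_F: "integrable P (\<lambda>\<xi>. F \<xi> w)" for w
  proof -
    have "\<bar>\<phi> s - \<phi> 0 - (s - 0) \<bullet> \<phi>' 0\<bar> \<le> M * (norm (s - 0))\<^sup>2" for s
    proof (rule linearization_error_le)
      show "GDERIV \<phi> z :> \<phi>' z" for z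
        using D\<phi> by simp
    qed (use \<phi>'_diff[of _ 0] in auto)
    then have \<phi>_lin: "\<bar>\<phi> s - \<phi> 0 - s * \<phi>' 0\<bar> \<le> M * s\<^sup>2" for s
      by simp
    have bnd: "\<bar>\<phi> s\<bar> \<le> \<bar>\<phi> 0\<bar> + \<phi>' 0 * \<bar>s\<bar> + M * s\<^sup>2" for s
    proof -
      have "\<bar>s * \<phi>' 0\<bar> = \<phi>' 0 * \<bar>s\<bar>"
        using \<phi>'_nonneg[of 0] by (simp add: abs_mult)
      with \<phi>_lin[of s] show ?thesis by linarith
    qed
    have "integrable P (\<lambda>\<xi>. \<phi> (u \<xi> w))"
    proof (rule Bochner_Integration.integrable_bound)
      show "integrable P (\<lambda>\<xi>. \<bar>\<phi> 0\<bar> + \<phi>' 0 * \<bar>u \<xi> w\<bar> + M * (u \<xi> w)\<^sup>2)"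
        using int_u int_u2 by auto
      show "AE \<xi> in P. norm (\<phi> (u \<xi> w)) \<le> norm (\<bar>\<phi> 0\<bar> + \<phi>' 0 * \<bar>u \<xi> w\<bar> + M * (u \<xi> w)\<^sup>2)"
        using bnd by (auto intro: order_trans[OF _ abs_ge_self])
    qed (rule meas_\<phi>)
    then show ?thesis by (simp add: F_def)
  qed
  have int_g: "integrable P (\<lambda>\<xi>. g \<xi> w)" for w
  proof (rule Bochner_Integration.integrable_bound)
    show "integrable P (\<lambda>\<xi>. p \<xi> w * G + (1 + p \<xi> w))"
      using int_p by auto
    show "(\<lambda>\<xi>. g \<xi> w) \<in> borel_measurable P"
      using borel_measurable_integrable[OF int_F] DF by (rule borel_measurable_GDERIV)
    have "norm (g \<xi> w) \<le> p \<xi> w * G + (1 + p \<xi> w)" if "\<xi> \<in> space P" for \<xi>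
    proof -
      have "norm (g \<xi> w) \<le> norm (p \<xi> w *\<^sub>R d \<xi> (fst w)) + \<bar>1 - p \<xi> w\<bar>"
        unfolding g_def by (metis norm_Pair_le real_norm_def)
      also have "\<dots> \<le> p \<xi> w * G + (1 + p \<xi> w)"
        using norm_d[OF that] p_nonneg[of \<xi> w] by (intro add_mono) (auto intro: mult_left_mono)
      finally show ?thesis .
    qed
    then show "AE \<xi> in P. norm (g \<xi> w) \<le> norm (p \<xi> w * G + (1 + p \<xi> w))"
      using p_nonneg G by (auto intro: order_trans[OF _ abs_ge_self])
  qed

  define g' where "g' w = (\<integral>\<xi>. g \<xi> w \<partial>P)" for w
  have obj: "dro_objective lam P \<psi> l = (\<lambda>w. \<integral>\<xi>. F \<xi> w \<partial>P)"
  proof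
    fix w :: "(real ^ 'd) \<times> real"
    have "integrable P (\<lambda>\<xi>. \<phi> (u \<xi> w))"
      using Bochner_Integration.integrable_diff[OF int_F[of w], of "\<lambda>_. snd w"] lam
      by (simp add: F_def)
    then show "dro_objective lam P \<psi> l w = (\<integral>\<xi>. F \<xi> w \<partial>P)"
      by (simp add: dro_objective_def F_def u_def \<phi>_def case_prod_beta prob_space)
  qed
  have int_C: "integrable P (\<lambda>\<xi>. K + Ll * p \<xi> w)" for w
    using int_p by auto
  have D: "GDERIV (dro_objective lam P \<psi> l) w :> g' w" for w
    unfolding obj g'_def by (rule GDERIV_integral[OF int_F int_g int_C DF g_diff])
  have mean_p: "(\<integral>\<xi>. p \<xi> w \<partial>P) \<le> 1 + norm (g' w)" for w
  proof -
    have "snd (g' w) = (\<integral>\<xi>. snd (g \<xi> w) \<partial>P)"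
      unfolding g'_def using int_g by (rule integral_bounded_linear[OF bounded_linear_snd, symmetric])
    also have "\<dots> = 1 - (\<integral>\<xi>. p \<xi> w \<partial>P)"
      using int_p by (simp add: g_def prob_space)
    finally have "snd (g' w) = 1 - (\<integral>\<xi>. p \<xi> w \<partial>P)" .
    moreover have "\<bar>snd (g' w)\<bar> \<le> norm (g' w)"
      by (metis norm_snd_le prod.collapse real_norm_def)
    ultimately show ?thesis
      by linarith
  qed
  \<comment> \<open>The summands \<open>1\<close> only keep both constants strictly positive when \<open>K\<close> and \<open>Ll\<close> vanish.\<close>
  have g'_diff: "norm (g' w' - g' w) \<le> (K + Ll + 1 + (Ll + 1) * norm (g' w)) * norm (w' - w)" for w w'
  proof -
    have "norm (g' w' - g' w) = norm (\<integral>\<xi>. g \<xi> w' - g \<xi> w \<partial>P)"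
      using int_g by (simp add: g'_def)
    also have "\<dots> \<le> (\<integral>\<xi>. (K + Ll * p \<xi> w) * norm (w' - w) \<partial>P)"
      using int_g int_C g_diff by (intro norm_integral_le_integral) auto
    also have "\<dots> = (K + Ll * (\<integral>\<xi>. p \<xi> w \<partial>P)) * norm (w' - w)"
      using int_p by (simp add: prob_space)
    also have "\<dots> \<le> (K + Ll * (1 + norm (g' w))) * norm (w' - w)"
      using mean_p Ll by (intro mult_right_mono add_left_mono mult_left_mono) auto
    also have "\<dots> \<le> (K + Ll + 1 + (Ll + 1) * norm (g' w)) * norm (w' - w)"
      by (intro mult_right_mono) (auto simp: algebra_simps)
    finally show ?thesis .
  qed
  show ?thesis
    using D _ _ g'_diff by (rule L_sym_star_1I) (use K Ll in auto)
qed

end
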